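(* Consider $\mathrm{Sol}(3)$ with parameter $p=0$, and let $F:(t_1,t_2)\times(s_1,s_2)\to\mathrm{Sol}(3)$ be a ruled surface. Then, in the global coordinates $(x,y,z)$, $F$ must have the form $$F(t,s)=\left(A_1+\frac{c_1}{\varepsilon}s,\ \ A_2+\frac1\alpha\left(c_2\cos(A_1)-c_3\sin(A_1)\right)s,\ \ A_3+\frac1\alpha\left(c_3\cos(A_1)+c_2\sin(A_1)\right)s\right),$$ where $c_1(t),c_2(t),c_3(t),A_1(t),A_2(t),A_3(t)$ are arbitrary smooth functions.
   Context: Fix $\varepsilon,\alpha>0$. For $p=0$, $\mathrm{Sol}(3)$ denotes the Lie group $\mathbb{R}^3$ with product $(x,y,z)\cdot(x',y',z')=(x+x',\ \exp(Ax)(y',z')+(y,z))$, where $A=\begin{pmatrix}0&-1\\1&0\end{pmatrix}$. Its left-invariant frame $e_1,e_2,e_3$ (equal to the standard basis at the identity) satisfies $[e_1,e_2]=e_3$, $[e_1,e_3]=-e_2$, $[e_2,e_3]=0$. With dual coframe $\lambda^1,\lambda^2,\lambda^3$, the group carries the left-invariant metric $g=\varepsilon^2(\lambda^1)^2+\alpha^2((\lambda^2)^2+(\lambda^3)^2)$. The frame $u_1=\frac1\varepsilon e_1$, $u_2=\frac1\alpha e_2$, $u_3=\frac1\alpha e_3$ is orthonormal; in the global coordinates, $u_1=\frac1\varepsilon\partial_x$, $u_2=\frac{1}{\alpha}(\cos x\,\partial_y+\sin x\,\partial_z)$, $u_3=\frac1\alpha(-\sin x\,\partial_y+\cos x\,\partial_z)$.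 A ruled surface is a smooth map $F(t,s)=\exp_{\gamma(t)}(sX(t))$ on $(t_1,t_2)\times(s_1,s_2)$, where $\gamma$ is a smooth curve, $X$ is a nowhere vanishing smooth vector field along $\gamma$, and $\exp$ is the Riemannian exponential map; thus $\nabla_{F_s}F_s=0$, with $F_s=dF(\partial_s)$ and $\nabla$ the Levi-Civita connection. *)

theory Defs
  imports "HOL-Analysis.Analysis"
begin

fun Ck_on :: "nat \<Rightarrow> 'a set \<Rightarrow> ('a::real_normed_vector \<Rightarrow> 'b::real_normed_vector) \<Rightarrow> bool"
  where
    "Ck_on 0 S f \<longleftrightarrow> continuous_on S f"
  | "Ck_on (Suc n) S f \<longleftrightarrow>
       (\<forall>x\<in>S. f differentiable (at x)) \<and>
       (\<forall>v. Ck_on n S (\<lambda>x. frechet_derivative f (at x) v))"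

(* Intended for open S; the values of f outside S are then irrelevant. *)
definition smooth_on :: "'a set \<Rightarrow> ('a::real_normed_vector \<Rightarrow> 'b::real_normed_vector) \<Rightarrow> bool"
  where "smooth_on S f \<longleftrightarrow> (\<forall>n. Ck_on n S f)"


section \<open>Riemannian metrics on a coordinate space\<close>

text \<open>A metric on the manifold \<open>\<real>\<^sup>n\<close> is a function \<open>g\<close> with \<open>g q v w\<close> the inner product of
  the tangent vectors \<open>v\<close>, \<open>w\<close> at \<open>q\<close>; tangent vectors are identified with their components in
  the global coordinates.\<close>

type_synonym 'n riem_metric = "real ^ 'n \<Rightarrow> real ^ 'n \<Rightarrow> real ^ 'n \<Rightarrow> real"

definition gram :: "('n::finite) riem_metric \<Rightarrow> real ^ 'n \<Rightarrow> real ^ 'n ^ 'n"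
  where "gram g q = (\<chi> i j. g q (axis i 1) (axis j 1))"

text \<open>\<open>gram_deriv g q k i j\<close> is the partial derivative \<open>\<partial>\<^sub>k g\<^sub>i\<^sub>j\<close> at \<open>q\<close>.\<close>

definition gram_deriv :: "('n::finite) riem_metric \<Rightarrow> real ^ 'n \<Rightarrow> 'n \<Rightarrow> 'n \<Rightarrow> 'n \<Rightarrow> real"
  where "gram_deriv g q k i j =
    frechet_derivative (\<lambda>r. gram g r $ i $ j) (at q) (axis k 1)"

text \<open>Christoffel symbols \<open>\<Gamma>\<^sup>k\<^sub>i\<^sub>j\<close> of the Levi-Civita connection.\<close>

definition christoffel :: "('n::finite) riem_metric \<Rightarrow> real ^ 'n \<Rightarrow> 'n \<Rightarrow> 'n \<Rightarrow> 'n \<Rightarrow> real"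
  where "christoffel g q k i j =
    (1 / 2) * (\<Sum>l\<in>UNIV. matrix_inv (gram g q) $ k $ l *
      (gram_deriv g q i j l + gram_deriv g q j i l - gram_deriv g q l i j))"

text \<open>The Levi-Civita covariant derivative, along the curve \<open>c\<close>, of the vector field \<open>V\<close>
  along \<open>c\<close>.\<close>

definition cov_deriv ::
    "('n::finite) riem_metric \<Rightarrow> (real \<Rightarrow> real ^ 'n) \<Rightarrow> (real \<Rightarrow> real ^ 'n) \<Rightarrow> real \<Rightarrow> real ^ 'n"
  where "cov_deriv g c V t =
    vector_derivative V (at t) +
    (\<chi> k. \<Sum>i\<in>UNIV. \<Sum>j\<in>UNIV.
       christoffel g (c t) k i j * vector_derivative c (at t) $ i * V t $ j)"

definition complete_geodesic :: "('n::finite) riem_metric \<Rightarrow> (real \<Rightarrow> real ^ 'n) \<Rightarrow> bool"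
  where "complete_geodesic g c \<longleftrightarrow>
    smooth_on UNIV c \<and> (\<forall>t. cov_deriv g c (\<lambda>u. vector_derivative c (at u)) t = 0)"

text \<open>The Riemannian exponential map. The definition through geodesics defined on all of \<open>\<real>\<close>
  is meant for complete metrics; left-invariant metrics on Lie groups are complete.\<close>

definition riem_exp :: "('n::finite) riem_metric \<Rightarrow> real ^ 'n \<Rightarrow> real ^ 'n \<Rightarrow> real ^ 'n"
  where "riem_exp g q v =
    (THE c. complete_geodesic g c \<and> c 0 = q \<and> vector_derivative c (at 0) = v) 1"

text \<open>Ruled surfaces over the open intervals \<open>(t1,t2)\<close> and \<open>(s1,s2)\<close>, whose end points may be
  infinite.\<close>

definition ruled_surface ::
    "('n::finite) riem_metric \<Rightarrow> ereal \<Rightarrow> ereal \<Rightarrow> ereal \<Rightarrow> ereal \<Rightarrow> (real \<times> real \<Rightarrow> real ^ 'n) \<Rightarrow> bool"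
  where "ruled_surface g t1 t2 s1 s2 F \<longleftrightarrow>
    smooth_on (einterval t1 t2 \<times> einterval s1 s2) F \<and>
    (\<exists>\<gamma> X. smooth_on (einterval t1 t2) \<gamma> \<and> smooth_on (einterval t1 t2) X \<and>
       (\<forall>t\<in>einterval t1 t2. X t \<noteq> 0) \<and>
       (\<forall>t\<in>einterval t1 t2. \<forall>s\<in>einterval s1 s2. F (t, s) = riem_exp g (\<gamma> t) (s *\<^sub>R X t)))"


section \<open>The group Sol(3) for p = 0 and its left-invariant metric\<close>

definition mat_exp :: "real ^ 'n ^ 'n \<Rightarrow> real ^ 'n ^ 'n"
  where "mat_exp M = (\<Sum>k. (1 / fact k) *\<^sub>R (((**) M ^^ k) (mat 1)))"

definition sol_A :: "real ^ 2 ^ 2"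
  where "sol_A = vector [vector [0, -1], vector [1, 0]]"

definition sol_mult :: "real ^ 3 \<Rightarrow> real ^ 3 \<Rightarrow> real ^ 3"
  where "sol_mult q r =
    (let w = mat_exp (q $ 1 *\<^sub>R sol_A) *v vector [r $ 2, r $ 3]
     in vector [q $ 1 + r $ 1, w $ 1 + q $ 2, w $ 2 + q $ 3])"

text \<open>The neutral element is \<open>0\<close>; the left-invariant vector field extending the \<open>i\<close>-th standard
  basis vector is its image under the differentials of the left translations.\<close>

definition sol_frame :: "3 \<Rightarrow> real ^ 3 \<Rightarrow> real ^ 3"
  where "sol_frame i q = frechet_derivative (sol_mult q) (at 0) (axis i 1)"

definition sol_coframe :: "3 \<Rightarrow> real ^ 3 \<Rightarrow> real ^ 3 \<Rightarrow> real"
  where "sol_coframe i q =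
    (THE l. linear l \<and> (\<forall>j. l (sol_frame j q) = (if j = i then 1 else 0)))"

definition sol_metric :: "real \<Rightarrow> real \<Rightarrow> 3 riem_metric"
  where "sol_metric \<epsilon> \<alpha> q v w =
    \<epsilon>\<^sup>2 * (sol_coframe 1 q v * sol_coframe 1 q w) +
    \<alpha>\<^sup>2 * (sol_coframe 2 q v * sol_coframe 2 q w + sol_coframe 3 q v * sol_coframe 3 q w)"

end

theory Submission imports Defs begin

text \<open>
  The Gram matrix of the metric in the global coordinates is \<open>diag(\<epsilon>\<^sup>2, \<alpha>\<^sup>2, \<alpha>\<^sup>2)\<close>,
  because \<open>u\<^sub>2\<close> and \<open>u\<^sub>3\<close> arise from \<open>\<partial>\<^sub>y / \<alpha>\<close> and \<open>\<partial>\<^sub>z / \<alpha>\<close> by a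
  rotation. The metric is therefore flat with constant coefficients, geodesics are affine lines, the
  exponential map is \<open>(q, v) \<mapsto> q + v\<close>, and a ruled surface is \<open>\<gamma>(t) + s X(t)\<close>. The functions
  \<open>c\<^sub>i\<close> are the components of \<open>X\<close> in the orthonormal frame at \<open>\<gamma>(t)\<close>.
\<close>

section \<open>Smooth functions\<close>

lemma Ck_on_imp_continuous_on:
  assumes "Ck_on n S f"
  shows "continuous_on S f"
proof (cases n)
  case 0
  then show ?thesis using assms by simp
next
  case (Suc m)
  then show ?thesis
    using assms by (auto intro!: continuous_at_imp_continuous_on differentiable_imp_continuous_within)
qed

text \<open>At order 0 this is continuity of differentiable functions; above it, the induction
  hypothesis is applied to each directional derivative.\<close>

lemma Ck_on_Suc_imp: "Ck_on (Suc n) S f \<Longrightarrow> Ck_on n S f"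
proof (induction n arbitrary: f)
  case 0
  then show ?case using Ck_on_imp_continuous_on[OF 0] by simp
next
  case (Suc n)
  show ?case
    unfolding Ck_on.simps(2)[of n] using Suc.IH Suc.prems Ck_on.simps(2)[of "Suc n" S f] by blast
qed

text \<open>Derivatives are taken at x in the whole space; since S is open, they depend only on the
  values in S.\<close>

lemma Ck_on_transform:
  assumes "open S" "Ck_on n S f" "\<And>x. x \<in> S \<Longrightarrow> f x = g x"
  shows "Ck_on n S g"
  using assms(2,3)
proof (induction n arbitrary: f g)
  case 0
  then show ?case by (simp cong: continuous_on_cong)
next
  case (Suc n)
  have D: "(g has_derivative frechet_derivative f (at x)) (at x)" if "x \<in> S" for x
  proof (rule has_derivative_transform_within_open[OF _ assms(1) that Suc.prems(2)])
    show "(f has_derivative frechet_derivative f (at x)) (at x)"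
      using Suc.prems(1) that by (simp flip: frechet_derivative_works)
  qed
  have "Ck_on n S (\<lambda>x. frechet_derivative g (at x) v)" for v
  proof (rule Suc.IH)
    show "Ck_on n S (\<lambda>x. frechet_derivative f (at x) v)"
      using Suc.prems by simp
    show "frechet_derivative f (at x) v = frechet_derivative g (at x) v" if "x \<in> S" for x
      using frechet_derivative_at[OF D[OF that]] by simp
  qed
  then show ?case using D by (auto simp: differentiable_def)
qed

text \<open>Permits an explicit derivative formula \<open>f'\<close> that is known to be correct on
  S only, in place of \<open>frechet_derivative\<close>.\<close>

lemma Ck_on_Suc_I:
  assumes "open S" "\<And>x. x \<in> S \<Longrightarrow> (f has_derivative f' x) (at x)"
    and "\<And>v. Ck_on n S (\<lambda>x. f' x v)"
  shows "Ck_on (Suc n) S f"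
proof -
  have "Ck_on n S (\<lambda>x. frechet_derivative f (at x) v)" for v
    by (rule Ck_on_transform[OF assms(1) assms(3)]) (simp add: frechet_derivative_at[OF assms(2)])
  then show ?thesis using assms(2) by (auto simp: differentiable_def)
qed

lemma Ck_on_SucD:
  assumes "Ck_on (Suc n) S f"
  shows "x \<in> S \<Longrightarrow> (f has_derivative frechet_derivative f (at x)) (at x)"
    and "Ck_on n S (\<lambda>x. frechet_derivative f (at x) v)"
  using assms frechet_derivative_works by auto

lemma Ck_on_const: "open S \<Longrightarrow> Ck_on n S (\<lambda>x. c)"
proof (induction n arbitrary: c)
  case (Suc n)
  show ?case
    by (rule Ck_on_Suc_I[OF Suc.prems has_derivative_const Suc.IH[OF Suc.prems]])
qed simp

lemma Ck_on_add:
  assumes "open S" "Ck_on n S f" "Ck_on n S g"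
  shows "Ck_on n S (\<lambda>x. f x + g x)"
  using assms(2,3)
proof (induction n arbitrary: f g)
  case 0
  then show ?case by (simp add: continuous_on_add)
next
  case (Suc n)
  show ?case
    by (rule Ck_on_Suc_I[OF assms(1) has_derivative_add[OF
          Ck_on_SucD(1)[OF Suc.prems(1)] Ck_on_SucD(1)[OF Suc.prems(2)]]])
      (assumption+, rule Suc.IH[OF Ck_on_SucD(2)[OF Suc.prems(1)] Ck_on_SucD(2)[OF Suc.prems(2)]])
qed

lemma (in bounded_linear) Ck_on_left:
  assumes "open S" "Ck_on n S g"
  shows "Ck_on n S (\<lambda>x. f (g x))"
  using assms(2)
proof (induction n arbitrary: g)
  case 0
  then show ?case by (simp add: continuous_on)
next
  case (Suc n)
  show ?case
    by (rule Ck_on_Suc_I[OF assms(1) has_derivative[OF Ck_on_SucD(1)[OF Suc.prems]]])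
      (assumption+, rule Suc.IH[OF Ck_on_SucD(2)[OF Suc.prems]])
qed

text \<open>The derivative in a fixed direction v is again precomposed with the same linear map f,
  and its outer function has one order less; this closes the induction.\<close>

lemma (in bounded_linear) Ck_on_right:
  assumes "open S" "Ck_on n T g" "f ` S \<subseteq> T"
  shows "Ck_on n S (\<lambda>x. g (f x))"
  using assms(2)
proof (induction n arbitrary: g)
  case 0
  then show ?case
    using continuous_on_compose2[OF _ linear_continuous_on[OF bounded_linear_axioms] assms(3)] by simp
next
  case (Suc n)
  have "((\<lambda>x. g (f x)) has_derivative (\<lambda>v. frechet_derivative g (at (f x)) (f v))) (at x)"
    if "x \<in> S" for x
    using has_derivative_compose[OF bounded_linear_imp_has_derivative[OF bounded_linear_axioms]
        Ck_on_SucD(1)[OF Suc.prems]] that assms(3) by blast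
  then show ?case
    by (rule Ck_on_Suc_I[OF assms(1)]) (assumption+, rule Suc.IH[OF Ck_on_SucD(2)[OF Suc.prems]])
qed

text \<open>Each summand of the product rule keeps one factor undifferentiated;
  \<open>Ck_on_Suc_imp\<close> lowers its order so that the induction hypothesis applies.\<close>

lemma (in bounded_bilinear) Ck_on_bilinear:
  assumes "open S" "Ck_on n S f" "Ck_on n S g"
  shows "Ck_on n S (\<lambda>x. prod (f x) (g x))"
  using assms(2,3)
proof (induction n arbitrary: f g)
  case 0
  then show ?case by (simp add: continuous_on)
next
  case (Suc n)
  show ?case
    by (rule Ck_on_Suc_I[OF assms(1) FDERIV[OF
          Ck_on_SucD(1)[OF Suc.prems(1)] Ck_on_SucD(1)[OF Suc.prems(2)]]])
      (assumption+, rule Ck_on_add[OF assms(1)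
          Suc.IH[OF Ck_on_Suc_imp[OF Suc.prems(1)] Ck_on_SucD(2)[OF Suc.prems(2)]]
          Suc.IH[OF Ck_on_SucD(2)[OF Suc.prems(1)] Ck_on_Suc_imp[OF Suc.prems(2)]]])
qed

text \<open>Both functions go through one induction because the derivative of each contains the
  other.\<close>

lemma Ck_on_sin_cos:
  fixes f :: "'a::real_normed_vector \<Rightarrow> real"
  assumes "open S" "Ck_on n S f"
  shows "Ck_on n S (\<lambda>x. sin (f x)) \<and> Ck_on n S (\<lambda>x. cos (f x))"
  using assms(2)
proof (induction n)
  case 0
  then show ?case by (simp add: continuous_on_sin continuous_on_cos)
next
  case (Suc n)
  let ?f' = "\<lambda>x. frechet_derivative f (at x)"
  have IH: "Ck_on n S (\<lambda>x. sin (f x))" "Ck_on n S (\<lambda>x. cos (f x))"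
    using Suc.IH Ck_on_Suc_imp[OF Suc.prems] by auto
  note mult = bounded_bilinear.Ck_on_bilinear[OF bounded_bilinear_mult assms(1)]
  note f' = Ck_on_SucD[OF Suc.prems]
  have "Ck_on (Suc n) S (\<lambda>x. sin (f x))"
  proof (rule Ck_on_Suc_I[OF assms(1), where f' = "\<lambda>x v. cos (f x) * ?f' x v"])
    show "((\<lambda>x. sin (f x)) has_derivative (\<lambda>v. cos (f x) * ?f' x v)) (at x)" if "x \<in> S" for x
      using has_derivative_sin[OF f'(1)[OF that]] by (simp add: mult.commute)
  qed (intro mult IH f'(2))
  moreover have "Ck_on (Suc n) S (\<lambda>x. cos (f x))"
  \<comment> \<open>The sign is written as a constant factor so that the product rule covers
    it.\<close>
  proof (rule Ck_on_Suc_I[OF assms(1), where f' = "\<lambda>x v. -1 * (sin (f x) * ?f' x v)"])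
    show "((\<lambda>x. cos (f x)) has_derivative (\<lambda>v. -1 * (sin (f x) * ?f' x v))) (at x)" if "x \<in> S" for x
      using has_derivative_cos[OF f'(1)[OF that]] by (simp add: mult.commute)
  qed (intro mult IH f'(2) Ck_on_const assms(1))
  ultimately show ?case by simp
qed

section \<open>Closure rules for smooth functions\<close>

lemma smooth_on_transform:
  "\<lbrakk>open S; smooth_on S f; \<And>x. x \<in> S \<Longrightarrow> f x = g x\<rbrakk> \<Longrightarrow> smooth_on S g"
  unfolding smooth_on_def using Ck_on_transform by blast

lemma smooth_on_const: "open S \<Longrightarrow> smooth_on S (\<lambda>x. c)"
  by (simp add: smooth_on_def Ck_on_const)

lemma smooth_on_add:
  "\<lbrakk>open S; smooth_on S f; smooth_on S g\<rbrakk> \<Longrightarrow> smooth_on S (\<lambda>x. f x + g x)"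
  by (simp add: smooth_on_def Ck_on_add)

lemma smooth_on_scaleR:
  "\<lbrakk>open S; smooth_on S f; smooth_on S g\<rbrakk> \<Longrightarrow> smooth_on S (\<lambda>x. f x *\<^sub>R g x)"
  by (simp add: smooth_on_def bounded_bilinear.Ck_on_bilinear[OF bounded_bilinear_scaleR])

lemma smooth_on_mult:
  fixes f g :: "'a::real_normed_vector \<Rightarrow> 'b::real_normed_algebra"
  shows "\<lbrakk>open S; smooth_on S f; smooth_on S g\<rbrakk> \<Longrightarrow> smooth_on S (\<lambda>x. f x * g x)"
  by (simp add: smooth_on_def bounded_bilinear.Ck_on_bilinear[OF bounded_bilinear_mult])

lemma smooth_on_diff:
  assumes "open S" "smooth_on S f" "smooth_on S g"
  shows "smooth_on S (\<lambda>x. f x - g x)"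
proof -
  have "smooth_on S (\<lambda>x. - g x)"
    using assms(3) bounded_linear.Ck_on_left[OF bounded_linear_minus[OF bounded_linear_ident] assms(1)]
    unfolding smooth_on_def by blast
  then show ?thesis using smooth_on_add[OF assms(1,2)] by fastforce
qed

lemma smooth_on_sin:
  fixes f :: "'a::real_normed_vector \<Rightarrow> real"
  shows "\<lbrakk>open S; smooth_on S f\<rbrakk> \<Longrightarrow> smooth_on S (\<lambda>x. sin (f x))"
  by (simp add: smooth_on_def Ck_on_sin_cos)

lemma smooth_on_cos:
  fixes f :: "'a::real_normed_vector \<Rightarrow> real"
  shows "\<lbrakk>open S; smooth_on S f\<rbrakk> \<Longrightarrow> smooth_on S (\<lambda>x. cos (f x))"
  by (simp add: smooth_on_def Ck_on_sin_cos)

lemma smooth_on_linear_left: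
  "\<lbrakk>bounded_linear h; open S; smooth_on S f\<rbrakk> \<Longrightarrow> smooth_on S (\<lambda>x. h (f x))"
  by (simp add: smooth_on_def bounded_linear.Ck_on_left)

lemma smooth_on_linear_right:
  "\<lbrakk>bounded_linear h; open S; smooth_on T f; h ` S \<subseteq> T\<rbrakk> \<Longrightarrow> smooth_on S (\<lambda>x. f (h x))"
  unfolding smooth_on_def using bounded_linear.Ck_on_right by blast

lemma bounded_linear_smooth_on:
  assumes "bounded_linear h" "open S"
  shows "smooth_on S h"
proof -
  have "Ck_on n S h" for n
  proof (cases n)
    case 0
    then show ?thesis using assms linear_continuous_on by auto
  next
    case (Suc m)
    show ?thesis
      unfolding Suc
      by (rule Ck_on_Suc_I[OF assms(2) bounded_linear_imp_has_derivative[OF assms(1)]])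
        (rule Ck_on_const[OF assms(2)])
  qed
  then show ?thesis by (simp add: smooth_on_def)
qed

text \<open>Reduces smoothness of a list of components to sums and scalar multiples of constant
  vectors.\<close>

lemma vector_3_eq_sum_axis:
  fixes a b c :: real
  shows "(vector [a, b, c] :: real ^ 3) = a *\<^sub>R axis 1 1 + b *\<^sub>R axis 2 1 + c *\<^sub>R axis 3 1"
  by (simp add: vec_eq_iff forall_3 axis_def)

lemma smooth_on_vector_3:
  fixes f g h :: "'a::real_normed_vector \<Rightarrow> real"
  assumes "open S" "smooth_on S f" "smooth_on S g" "smooth_on S h"
  shows "smooth_on S (\<lambda>x. vector [f x, g x, h x] :: real ^ 3)"
  unfolding vector_3_eq_sum_axis
  by (intro smooth_on_add smooth_on_scaleR smooth_on_const assms)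


section \<open>Geodesics of a metric with constant coefficients\<close>

text \<open>Every Christoffel symbol is a combination of derivatives of metric coefficients, and
  these vanish here.\<close>

lemma cov_deriv_const_gram:
  assumes "\<And>q. gram g q = G"
  shows "cov_deriv g c V t = vector_derivative V (at t)"
proof -
  have "christoffel g q k i j = 0" for q k i j
    by (simp add: christoffel_def gram_deriv_def assms frechet_derivative_const)
  then show ?thesis by (simp add: cov_deriv_def vec_eq_iff)
qed

lemma smooth_on_vector_derivative:
  assumes "open S" "smooth_on S f"
  shows "smooth_on S (\<lambda>t. vector_derivative f (at t))"
  unfolding smooth_on_def
proof
  fix n
  have f: "Ck_on (Suc n) S f" using assms(2) by (simp add: smooth_on_def)
  show "Ck_on n S (\<lambda>t. vector_derivative f (at t))"
  proof (rule Ck_on_transform[OF assms(1) Ck_on_SucD(2)[OF f]])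
    show "frechet_derivative f (at t) 1 = vector_derivative f (at t)" if "t \<in> S" for t
      using frechet_derivative_eq_vector_derivative[of f t] f that by simp
  qed
qed

lemma smooth_on_has_vector_derivative:
  assumes "smooth_on S f" "t \<in> S"
  shows "(f has_vector_derivative vector_derivative f (at t)) (at t)"
proof -
  have "Ck_on (Suc 0) S f" using assms(1) by (simp only: smooth_on_def)
  then show ?thesis using assms(2) by (simp flip: vector_derivative_works)
qed

text \<open>Subtracting the linear motion with velocity v leaves a function of zero derivative,
  hence a constant.\<close>

lemma has_vector_derivative_const_imp_affine:
  fixes f :: "real \<Rightarrow> 'a::real_normed_vector"
  assumes "\<And>t. (f has_vector_derivative v) (at t)"
  shows "f t = f 0 + t *\<^sub>R v"
proof -
  have "((\<lambda>t. f t - t *\<^sub>R v) has_vector_derivative v - 1 *\<^sub>R v) (at t)" for t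
    by (intro has_vector_derivative_diff assms has_vector_derivative_scaleR[where g' = 0, simplified])
      (auto intro!: derivative_eq_intros)
  then have "((\<lambda>t. f t - t *\<^sub>R v) has_derivative (\<lambda>h. 0)) (at t)" for t
    by (simp add: has_vector_derivative_def)
  from has_derivative_zero_unique[OF convex_UNIV this, of t 0] show ?thesis
    by (simp add: algebra_simps)
qed

text \<open>The geodesic equation reads c'' = 0 and is integrated twice. The equivalence gives
  existence and uniqueness together, as the definite description in \<open>riem_exp\<close>
  requires.\<close>

lemma complete_geodesic_const_gram:
  assumes "\<And>q. gram g q = G"
  shows "complete_geodesic g c \<and> c 0 = q \<and> vector_derivative c (at 0) = v \<longleftrightarrow>
    c = (\<lambda>s. q + s *\<^sub>R v)"
proof
  assume c: "complete_geodesic g c \<and> c 0 = q \<and> vector_derivative c (at 0) = v"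
  then have smooth: "smooth_on UNIV c"
    and geo: "vector_derivative (\<lambda>u. vector_derivative c (at u)) (at t) = 0" for t
    by (auto simp: complete_geodesic_def cov_deriv_const_gram[OF assms])
  let ?c' = "\<lambda>t. vector_derivative c (at t)"
  have "(?c' has_vector_derivative 0) (at t)" for t
    using smooth_on_has_vector_derivative[OF smooth_on_vector_derivative[OF open_UNIV smooth], of t] geo
    by simp
  \<comment> \<open>First integration, with slope 0: the velocity keeps its initial value.\<close>
  from has_vector_derivative_const_imp_affine[OF this] c have "?c' t = v" for t
    by simp
  then have "(c has_vector_derivative v) (at t)" for t
    using smooth_on_has_vector_derivative[OF smooth, of t] by simp
  from has_vector_derivative_const_imp_affine[OF this] c show "c = (\<lambda>s. q + s *\<^sub>R v)"
    by blast
next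
  assume c: "c = (\<lambda>s. q + s *\<^sub>R v)"
  have D: "vector_derivative c (at t) = v" for t
    unfolding c by (rule vector_derivative_at) (auto intro!: derivative_eq_intros)
  have "smooth_on UNIV c"
    unfolding c
    by (intro smooth_on_add smooth_on_scaleR smooth_on_const bounded_linear_smooth_on
        bounded_linear_ident open_UNIV)
  then show "complete_geodesic g c \<and> c 0 = q \<and> vector_derivative c (at 0) = v"
    by (simp add: complete_geodesic_def cov_deriv_const_gram[OF assms] D) (simp add: c)
qed

lemma riem_exp_const_gram:
  assumes "\<And>q. gram g q = G"
  shows "riem_exp g q v = q + v"
  by (simp add: riem_exp_def complete_geodesic_const_gram[OF assms])


section \<open>The metric of Sol(3) in global coordinates\<close>

text \<open>The matrix of multiplication by z on the complex plane in the basis 1, i. This algebra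
  embedding carries the complex exponential over to matrices.\<close>

definition complex_matrix :: "complex \<Rightarrow> real ^ 2 ^ 2"
  where "complex_matrix z = vector [vector [Re z, - Im z], vector [Im z, Re z]]"

lemma bounded_linear_complex_matrix: "bounded_linear complex_matrix"
proof (rule linear_conv_bounded_linear[THEN iffD1])
  show "linear complex_matrix"
    by (rule linearI) (simp_all add: complex_matrix_def vec_eq_iff forall_2)
qed

lemma complex_matrix_mult: "complex_matrix (z * w) = complex_matrix z ** complex_matrix w"
  by (simp add: complex_matrix_def vec_eq_iff forall_2 matrix_matrix_mult_def sum_2)

lemma complex_matrix_power: "complex_matrix (z ^ n) = ((**) (complex_matrix z) ^^ n) (mat 1)"
proof (induction n)
  case 0
  show ?case by (simp add: complex_matrix_def vec_eq_iff forall_2 mat_def)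
next
  case (Suc n)
  then show ?case by (simp add: complex_matrix_mult)
qed

text \<open>A bounded linear map may be applied to the exponential series term by term, and this one
  preserves powers.\<close>

lemma mat_exp_complex_matrix: "mat_exp (complex_matrix z) = complex_matrix (exp z)"
proof -
  have "(\<lambda>n. z ^ n /\<^sub>R fact n) sums exp z"
    by (rule exp_converges)
  from bounded_linear.sums[OF bounded_linear_complex_matrix this] show ?thesis
    by (simp add: mat_exp_def sums_iff complex_matrix_power divide_inverse
        linear_cmul[OF bounded_linear.linear[OF bounded_linear_complex_matrix]])
qed

lemma mat_exp_sol_A:
  "mat_exp (x *\<^sub>R sol_A) = vector [vector [cos x, - sin x], vector [sin x, cos x]]"
proof -
  \<comment> \<open>\<open>sol_A\<close> represents the imaginary unit.\<close>
  have "x *\<^sub>R sol_A = complex_matrix (\<i> * of_real x)"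
    by (simp add: sol_A_def complex_matrix_def vec_eq_iff forall_2)
  then have "mat_exp (x *\<^sub>R sol_A) = complex_matrix (cis x)"
    by (simp add: mat_exp_complex_matrix cis_conv_exp)
  then show ?thesis by (simp add: complex_matrix_def)
qed

section \<open>Left translations, invariant frame and dual coframe\<close>

lemma sol_mult_eq:
  "sol_mult q r = vector [q $ 1 + r $ 1,
     cos (q $ 1) * r $ 2 - sin (q $ 1) * r $ 3 + q $ 2,
     sin (q $ 1) * r $ 2 + cos (q $ 1) * r $ 3 + q $ 3]"
  by (simp add: sol_mult_def mat_exp_sol_A matrix_vector_mult_def sum_2)

lemma frechet_derivative_sol_mult:
  "frechet_derivative (sol_mult q) (at 0) v = vector [v $ 1,
     cos (q $ 1) * v $ 2 - sin (q $ 1) * v $ 3,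
     sin (q $ 1) * v $ 2 + cos (q $ 1) * v $ 3]" (is "_ = ?L v")
proof -
  have "linear ?L"
    by (rule linearI) (simp_all add: vec_eq_iff forall_3 algebra_simps)
  then have "bounded_linear ?L" by (simp only: linear_conv_bounded_linear)
  from has_derivative_add[OF has_derivative_const bounded_linear_imp_has_derivative[OF this]]
  have "((\<lambda>r. q + ?L r) has_derivative ?L) (at 0)" by simp
  \<comment> \<open>A left translation is affine, so its derivative is its linear part, the rotation
    of the last two coordinates by the angle \<open>q $ 1\<close>.\<close>
  moreover have "sol_mult q = (\<lambda>r. q + ?L r)"
    by (auto simp: sol_mult_eq vec_eq_iff forall_3)
  ultimately have "(sol_mult q has_derivative ?L) (at 0)" by simp
  from fun_cong[OF frechet_derivative_at[OF this], of v] show ?thesis by simp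
qed

lemma sol_frame_eq:
  "sol_frame 1 q = axis 1 1"
  "sol_frame 2 q = cos (q $ 1) *\<^sub>R axis 2 1 + sin (q $ 1) *\<^sub>R axis 3 1"
  "sol_frame 3 q = - sin (q $ 1) *\<^sub>R axis 2 1 + cos (q $ 1) *\<^sub>R axis 3 1"
  by (simp_all add: sol_frame_def frechet_derivative_sol_mult vec_eq_iff forall_3 axis_def)

text \<open>The coefficients arise by rotating the last two components back by the angle
  \<open>q $ 1\<close>. In particular the frame spans the tangent space.\<close>

lemma vec_eq_sum_sol_frame:
  "v = v $ 1 *\<^sub>R sol_frame 1 q
     + (cos (q $ 1) * v $ 2 + sin (q $ 1) * v $ 3) *\<^sub>R sol_frame 2 q
     + (cos (q $ 1) * v $ 3 - sin (q $ 1) * v $ 2) *\<^sub>R sol_frame 3 q"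
proof -
  have rot: "cos x * (cos x * y) + sin x * (sin x * y) = y" for x y :: real
    by (simp flip: mult.assoc distrib_right)
  show ?thesis
    by (simp add: sol_frame_eq vec_eq_iff forall_3 axis_def algebra_simps rot)
qed

text \<open>Two linear forms with the same values on the spanning frame coincide, which settles the
  uniqueness in the definite description.\<close>

lemma sol_coframe_eqI:
  assumes "linear l" "\<And>j. l (sol_frame j q) = (if j = i then 1 else 0)"
  shows "sol_coframe i q = l"
  unfolding sol_coframe_def
proof (rule the_equality)
  show "linear l \<and> (\<forall>j. l (sol_frame j q) = (if j = i then 1 else 0))"
    using assms by blast
next
  fix m :: "real ^ 3 \<Rightarrow> real"
  assume m: "linear m \<and> (\<forall>j. m (sol_frame j q) = (if j = i then 1 else 0))"
  show "m = l"
  proof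
    fix v
    have "m (a *\<^sub>R sol_frame 1 q + b *\<^sub>R sol_frame 2 q + c *\<^sub>R sol_frame 3 q) =
        l (a *\<^sub>R sol_frame 1 q + b *\<^sub>R sol_frame 2 q + c *\<^sub>R sol_frame 3 q)" for a b c
      using m assms by (simp add: linear_add linear_cmul)
    then show "m v = l v"
      using vec_eq_sum_sol_frame[of v q] by metis
  qed
qed

lemma sol_coframe_eq:
  "sol_coframe 1 q v = v $ 1"
  "sol_coframe 2 q v = cos (q $ 1) * v $ 2 + sin (q $ 1) * v $ 3"
  "sol_coframe 3 q v = cos (q $ 1) * v $ 3 - sin (q $ 1) * v $ 2"
proof -
  have "sol_coframe 1 q = (\<lambda>v. v $ 1)"
  proof (rule sol_coframe_eqI)
    show "sol_frame j q $ 1 = (if j = 1 then 1 else 0)" for j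
      using exhaust_3[of j] by (auto simp: sol_frame_eq axis_def)
  qed (auto intro: linearI)
  moreover have "sol_coframe 2 q = (\<lambda>v. cos (q $ 1) * v $ 2 + sin (q $ 1) * v $ 3)"
  proof (rule sol_coframe_eqI)
    show "cos (q $ 1) * sol_frame j q $ 2 + sin (q $ 1) * sol_frame j q $ 3 =
        (if j = 2 then 1 else 0)" for j
      using exhaust_3[of j] by (auto simp: sol_frame_eq axis_def)
  qed (auto intro!: linearI simp: algebra_simps)
  moreover have "sol_coframe 3 q = (\<lambda>v. cos (q $ 1) * v $ 3 - sin (q $ 1) * v $ 2)"
  proof (rule sol_coframe_eqI)
    show "cos (q $ 1) * sol_frame j q $ 3 - sin (q $ 1) * sol_frame j q $ 2 =
        (if j = 3 then 1 else 0)" for j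
      using exhaust_3[of j] by (auto simp: sol_frame_eq axis_def)
  qed (auto intro!: linearI simp: algebra_simps)
  ultimately show
    "sol_coframe 1 q v = v $ 1"
    "sol_coframe 2 q v = cos (q $ 1) * v $ 2 + sin (q $ 1) * v $ 3"
    "sol_coframe 3 q v = cos (q $ 1) * v $ 3 - sin (q $ 1) * v $ 2"
    by simp_all
qed

text \<open>Rotations preserve the Euclidean inner product, so the dependence on q cancels.\<close>

lemma sol_metric_eq:
  "sol_metric \<epsilon> \<alpha> q v w = \<epsilon>\<^sup>2 * (v $ 1 * w $ 1) + \<alpha>\<^sup>2 * (v $ 2 * w $ 2 + v $ 3 * w $ 3)"
proof -
  have "(cos x * a + sin x * b) * (cos x * c + sin x * d)
      + (cos x * b - sin x * a) * (cos x * d - sin x * c)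
      = (cos x * cos x + sin x * sin x) * (a * c + b * d)" for x a b c d :: real
    by (simp only: algebra_simps)
  then show ?thesis by (simp add: sol_metric_def sol_coframe_eq)
qed

section \<open>Exponential map and ruled surfaces of Sol(3)\<close>

lemma riem_exp_sol_metric: "riem_exp (sol_metric \<epsilon> \<alpha>) q v = q + v"
  by (rule riem_exp_const_gram[where G = "gram (sol_metric \<epsilon> \<alpha>) 0"])
    (simp add: gram_def sol_metric_eq)

lemma ruled_surface_sol_metric_iff:
  "ruled_surface (sol_metric \<epsilon> \<alpha>) t1 t2 s1 s2 F \<longleftrightarrow>
    (\<exists>\<gamma> X. smooth_on (einterval t1 t2) \<gamma> \<and> smooth_on (einterval t1 t2) X \<and>
       (\<forall>t\<in>einterval t1 t2. X t \<noteq> 0) \<and>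
       (\<forall>t\<in>einterval t1 t2. \<forall>s\<in>einterval s1 s2. F (t, s) = \<gamma> t + s *\<^sub>R X t))"
  (is "_ \<longleftrightarrow> ?R")
proof
  assume ?R
  then obtain \<gamma> X where *: "smooth_on (einterval t1 t2) \<gamma>" "smooth_on (einterval t1 t2) X"
    and F: "\<forall>t\<in>einterval t1 t2. \<forall>s\<in>einterval s1 s2. F (t, s) = \<gamma> t + s *\<^sub>R X t"
    by blast
  let ?S = "einterval t1 t2 \<times> einterval s1 s2"
  \<comment> \<open>Smoothness of F: on the open rectangle it agrees with an expression built from
    \<gamma>, X and the two linear projections.\<close>
  have "open ?S" by (simp add: open_Times)
  then have "smooth_on ?S (\<lambda>p. \<gamma> (fst p) + snd p *\<^sub>R X (fst p))"
    by (intro smooth_on_add smooth_on_scaleR bounded_linear_smooth_on bounded_linear_snd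
        smooth_on_linear_right[OF bounded_linear_fst _ *(1)]
        smooth_on_linear_right[OF bounded_linear_fst _ *(2)]) auto
  then have "smooth_on ?S F"
    by (rule smooth_on_transform[OF \<open>open ?S\<close>]) (use F in auto)
  with \<open>?R\<close> show "ruled_surface (sol_metric \<epsilon> \<alpha>) t1 t2 s1 s2 F"
    by (simp add: ruled_surface_def riem_exp_sol_metric)
qed (simp add: ruled_surface_def riem_exp_sol_metric)

text \<open>Rotation by -x followed by rotation by x is the identity on (a, b).\<close>

lemma rotation_inverse:
  fixes x a b :: real
  shows "(a * cos x + b * sin x) * cos x - (b * cos x - a * sin x) * sin x = a"
    and "(b * cos x - a * sin x) * cos x + (a * cos x + b * sin x) * sin x = b"
proof -
  have "(a * cos x + b * sin x) * cos x - (b * cos x - a * sin x) * sin x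
      = a * (cos x * cos x + sin x * sin x)"
    "(b * cos x - a * sin x) * cos x + (a * cos x + b * sin x) * sin x
      = b * (cos x * cos x + sin x * sin x)"
    by (simp_all only: algebra_simps)
  then show "(a * cos x + b * sin x) * cos x - (b * cos x - a * sin x) * sin x = a"
    and "(b * cos x - a * sin x) * cos x + (a * cos x + b * sin x) * sin x = b"
    by simp_all
qed

text \<open>The direction from right to left expresses that the functions are arbitrary, up to the
  condition that the \<open>c\<close>'s never vanish simultaneously; this corresponds to X having no
  zeros.\<close>

theorem theorem4p2:
  fixes \<epsilon> \<alpha> :: real and t1 t2 s1 s2 :: ereal and F :: "real \<times> real \<Rightarrow> real ^ 3"
  assumes "\<epsilon> > 0" and "\<alpha> > 0" and "t1 < t2" and "s1 < s2"
  shows "ruled_surface (sol_metric \<epsilon> \<alpha>) t1 t2 s1 s2 F \<longleftrightarrow>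
    (\<exists>c1 c2 c3 A1 A2 A3 :: real \<Rightarrow> real.
       (\<forall>f\<in>{c1, c2, c3, A1, A2, A3}. smooth_on (einterval t1 t2) f) \<and>
       (\<forall>t\<in>einterval t1 t2. (c1 t, c2 t, c3 t) \<noteq> (0, 0, 0)) \<and>
       (\<forall>t\<in>einterval t1 t2. \<forall>s\<in>einterval s1 s2.
          F (t, s) = vector
            [A1 t + c1 t / \<epsilon> * s,
             A2 t + 1 / \<alpha> * (c2 t * cos (A1 t) - c3 t * sin (A1 t)) * s,
             A3 t + 1 / \<alpha> * (c3 t * cos (A1 t) + c2 t * sin (A1 t)) * s]))"
proof -
  let ?I = "einterval t1 t2" and ?J = "einterval s1 s2"
  show ?thesis
    unfolding ruled_surface_sol_metric_iff
  proof (intro iffI; elim exE conjE)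
    fix \<gamma> X :: "real \<Rightarrow> real ^ 3"
    assume smooth: "smooth_on ?I \<gamma>" "smooth_on ?I X" and nz: "\<forall>t\<in>?I. X t \<noteq> 0"
      and F: "\<forall>t\<in>?I. \<forall>s\<in>?J. F (t, s) = \<gamma> t + s *\<^sub>R X t"
    \<comment> \<open>The coframe values of X at \<gamma>(t), scaled by \<epsilon> or \<alpha>
      because the frame vectors are divided by these lengths. The \<open>A\<close>'s will be the
      coordinates of \<gamma>.\<close>
    define c1 where "c1 = (\<lambda>t. \<epsilon> * X t $ 1)"
    define c2 where "c2 = (\<lambda>t. \<alpha> * (X t $ 2 * cos (\<gamma> t $ 1) + X t $ 3 * sin (\<gamma> t $ 1)))"
    define c3 where "c3 = (\<lambda>t. \<alpha> * (X t $ 3 * cos (\<gamma> t $ 1) - X t $ 2 * sin (\<gamma> t $ 1)))"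
    have X: "X t = vector [c1 t / \<epsilon>,
        1 / \<alpha> * (c2 t * cos (\<gamma> t $ 1) - c3 t * sin (\<gamma> t $ 1)),
        1 / \<alpha> * (c3 t * cos (\<gamma> t $ 1) + c2 t * sin (\<gamma> t $ 1))]" for t
      using assms(1,2)
        rotation_inverse[where a = "X t $ 2" and x = "\<gamma> t $ 1" and b = "X t $ 3"]
      by (simp add: c1_def c2_def c3_def vec_eq_iff forall_3 mult.assoc
          flip: right_diff_distrib distrib_left)
    have comp: "smooth_on ?I (\<lambda>t. \<gamma> t $ i)" "smooth_on ?I (\<lambda>t. X t $ i)" for i
      using smooth by (auto intro!: smooth_on_linear_left[OF bounded_linear_vec_nth])
    have "smooth_on ?I c1" "smooth_on ?I c2" "smooth_on ?I c3"
      unfolding c1_def c2_def c3_def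
      by (intro smooth_on_add smooth_on_diff smooth_on_mult smooth_on_const smooth_on_sin
          smooth_on_cos comp open_einterval)+
    with comp(1) have "\<forall>f\<in>{c1, c2, c3, \<lambda>t. \<gamma> t $ 1, \<lambda>t. \<gamma> t $ 2, \<lambda>t. \<gamma> t $ 3}. smooth_on ?I f"
      by simp
    \<comment> \<open>X is linear in the \<open>c\<close>'s, so it would vanish with them.\<close>
    moreover have "\<forall>t\<in>?I. (c1 t, c2 t, c3 t) \<noteq> (0, 0, 0)"
    proof (intro ballI notI)
      fix t
      assume "t \<in> ?I"
      assume "(c1 t, c2 t, c3 t) = (0, 0, 0)"
      then have "X t = 0" using X[of t] by (simp add: vec_eq_iff forall_3)
      with nz \<open>t \<in> ?I\<close> show False by blast
    qed
    moreover have "\<forall>t\<in>?I. \<forall>s\<in>?J. F (t, s) = vector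
        [\<gamma> t $ 1 + c1 t / \<epsilon> * s,
         \<gamma> t $ 2 + 1 / \<alpha> * (c2 t * cos (\<gamma> t $ 1) - c3 t * sin (\<gamma> t $ 1)) * s,
         \<gamma> t $ 3 + 1 / \<alpha> * (c3 t * cos (\<gamma> t $ 1) + c2 t * sin (\<gamma> t $ 1)) * s]"
      using F X by (simp add: vec_eq_iff forall_3)
    ultimately show "\<exists>c1 c2 c3 A1 A2 A3 :: real \<Rightarrow> real.
       (\<forall>f\<in>{c1, c2, c3, A1, A2, A3}. smooth_on ?I f) \<and>
       (\<forall>t\<in>?I. (c1 t, c2 t, c3 t) \<noteq> (0, 0, 0)) \<and>
       (\<forall>t\<in>?I. \<forall>s\<in>?J.
          F (t, s) = vector
            [A1 t + c1 t / \<epsilon> * s,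
             A2 t + 1 / \<alpha> * (c2 t * cos (A1 t) - c3 t * sin (A1 t)) * s,
             A3 t + 1 / \<alpha> * (c3 t * cos (A1 t) + c2 t * sin (A1 t)) * s])"
      by (intro exI conjI)
  next
    fix c1 c2 c3 A1 A2 A3 :: "real \<Rightarrow> real"
    assume all: "\<forall>f\<in>{c1, c2, c3, A1, A2, A3}. smooth_on ?I f"
      and nz: "\<forall>t\<in>?I. (c1 t, c2 t, c3 t) \<noteq> (0, 0, 0)"
      and F: "\<forall>t\<in>?I. \<forall>s\<in>?J. F (t, s) = vector
            [A1 t + c1 t / \<epsilon> * s,
             A2 t + 1 / \<alpha> * (c2 t * cos (A1 t) - c3 t * sin (A1 t)) * s,
             A3 t + 1 / \<alpha> * (c3 t * cos (A1 t) + c2 t * sin (A1 t)) * s]"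
    have smooth: "smooth_on ?I c1" "smooth_on ?I c2" "smooth_on ?I c3"
      "smooth_on ?I A1" "smooth_on ?I A2" "smooth_on ?I A3"
      using all by blast+
    \<comment> \<open>\<gamma> and X are the constant term and the coefficient of s. The quotient by
      \<epsilon> becomes a product so that \<open>smooth_on_mult\<close> applies.\<close>
    define \<gamma> :: "real \<Rightarrow> real ^ 3" where "\<gamma> = (\<lambda>t. vector [A1 t, A2 t, A3 t])"
    define X :: "real \<Rightarrow> real ^ 3" where "X = (\<lambda>t. vector [1 / \<epsilon> * c1 t,
        1 / \<alpha> * (c2 t * cos (A1 t) - c3 t * sin (A1 t)),
        1 / \<alpha> * (c3 t * cos (A1 t) + c2 t * sin (A1 t))])"
    have "smooth_on ?I \<gamma>" "smooth_on ?I X"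
      unfolding \<gamma>_def X_def
      by (intro smooth_on_vector_3 smooth_on_add smooth_on_diff smooth_on_mult smooth_on_const
          smooth_on_sin smooth_on_cos open_einterval smooth)+
    moreover have "X t \<noteq> 0" if "t \<in> ?I" for t
    proof
      assume "X t = 0"
      then have c: "c1 t = 0" "c2 t * cos (A1 t) - c3 t * sin (A1 t) = 0"
        "c3 t * cos (A1 t) + c2 t * sin (A1 t) = 0"
        using assms(1,2) by (auto simp: X_def vec_eq_iff forall_3)
      \<comment> \<open>Undoing the rotation by \<open>A1 t\<close> recovers \<open>c2 t\<close> and
        \<open>c3 t\<close> from two expressions that are zero.\<close>
      have "c2 t = (c2 t * cos (A1 t) - c3 t * sin (A1 t)) * cos (A1 t)
          + (c3 t * cos (A1 t) + c2 t * sin (A1 t)) * sin (A1 t)"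
        "c3 t = (c3 t * cos (A1 t) + c2 t * sin (A1 t)) * cos (A1 t)
          - (c2 t * cos (A1 t) - c3 t * sin (A1 t)) * sin (A1 t)"
        using rotation_inverse[where a = "c2 t" and x = "- A1 t" and b = "c3 t"] by simp_all
      then have "c2 t = 0" "c3 t = 0"
        unfolding c(2,3) by simp_all
      with c(1) nz that show False by simp
    qed
    moreover have "F (t, s) = \<gamma> t + s *\<^sub>R X t" if "t \<in> ?I" "s \<in> ?J" for t s
      using F that by (simp add: \<gamma>_def X_def vec_eq_iff forall_3)
    ultimately show "\<exists>\<gamma> X. smooth_on ?I \<gamma> \<and> smooth_on ?I X \<and> (\<forall>t\<in>?I. X t \<noteq> 0) \<and>
        (\<forall>t\<in>?I. \<forall>s\<in>?J. F (t, s) = \<gamma> t + s *\<^sub>R X t)"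
      by blast
  qed
qed

end
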